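(* Let $k$ be an algebraically closed field of characteristic zero and let $\mathcal{O}$ be a complete local noetherian integral $k$-algebra of dimension one with normalization $k[[t]]$ and semigroup $\Gamma$. Let $r$ be a codimension and let $\mathcal{I}_r$ be the set of all nonzero ideals of $\mathcal{O}$ of codimension $r$. Then there exist finitely many distinct $\Gamma$-modules $S_1,\dots,S_l$ such that $$\mathcal{I}_r=\bigcup_{i=1}^{l}\mathcal{I}(S_i),$$ where $\mathcal{I}(S_i)\cap\mathcal{I}(S_j)=\emptyset$ for $i\ne j$.
   Context: For nonzero $f\in k[[t]]$, $\mathrm{ord}(f)$ is its $t$-order. $\Gamma=\{\mathrm{ord}(f)\mid 0\neq f\in\mathcal{O}\}$. A $\Gamma$-module is a subset $S\subseteq\Gamma$ with $s_1+s_2\in S$ for all $s_1,s_2\in S$ and $s+\gamma\in S$ for all $s\in S$, $\gamma\in\Gamma$. For a nonzero ideal $I$ of $\mathcal{O}$, its codimension is $\dim_k\mathcal{O}/I$ and its order set is $\Gamma(I)=\{\mathrm{ord}(f)\mid 0\ne f\in I\}$, which is a $\Gamma$-module. For a $\Gamma$-module $S$, $\mathcal{I}(S)$ denotes the set of all nonzero ideals $I$ of $\mathcal{O}$ with $\Gamma(I)=S$. *)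

theory Defs
  imports
    "HOL-Algebra.Algebra"
    "HOL-Algebra.Algebraic_Closure_Type"
    "HOL-Library.Extended_Nat"
begin

section \<open>Commutative algebra\<close>

definition local_ring :: "('a, 'b) ring_scheme \<Rightarrow> bool" where
  "local_ring R \<longleftrightarrow> cring R \<and> (\<exists>!M. maximalideal M R)"

definition max_ideal :: "('a, 'b) ring_scheme \<Rightarrow> 'a set" where
  "max_ideal R = (THE M. maximalideal M R)"

definition ideal_power :: "('a, 'b) ring_scheme \<Rightarrow> 'a set \<Rightarrow> nat \<Rightarrow> 'a set" where
  "ideal_power R I n = I [^]\<^bsub>ideals_set R\<^esub> n"

definition adic_cauchy :: "('a, 'b) ring_scheme \<Rightarrow> 'a set \<Rightarrow> (nat \<Rightarrow> 'a) \<Rightarrow> bool" where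
  "adic_cauchy R I s \<longleftrightarrow>
     (\<forall>i. s i \<in> carrier R) \<and>
     (\<forall>n. \<exists>N. \<forall>i\<ge>N. \<forall>j\<ge>N. s i \<ominus>\<^bsub>R\<^esub> s j \<in> ideal_power R I n)"

definition adic_tendsto :: "('a, 'b) ring_scheme \<Rightarrow> 'a set \<Rightarrow> (nat \<Rightarrow> 'a) \<Rightarrow> 'a \<Rightarrow> bool" where
  "adic_tendsto R I s x \<longleftrightarrow>
     x \<in> carrier R \<and> (\<forall>n. \<exists>N. \<forall>i\<ge>N. s i \<ominus>\<^bsub>R\<^esub> x \<in> ideal_power R I n)"

text \<open>Uniqueness of the limits expresses that the adic topology is separated.\<close>

definition complete_local_ring :: "('a, 'b) ring_scheme \<Rightarrow> bool" where
  "complete_local_ring R \<longleftrightarrow>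
     local_ring R \<and>
     (\<forall>s. adic_cauchy R (max_ideal R) s \<longrightarrow> (\<exists>!x. adic_tendsto R (max_ideal R) s x))"

definition krull_dimension :: "('a, 'b) ring_scheme \<Rightarrow> enat" where
  "krull_dimension R =
     Sup {enat d | d. \<exists>P :: nat \<Rightarrow> 'a set.
            (\<forall>i\<le>d. primeideal (P i) R) \<and> (\<forall>i<d. P i \<subset> P (Suc i))}"

text \<open>Polynomials are coefficient lists with the leading coefficient in front.\<close>

definition integral_over :: "('a, 'b) ring_scheme \<Rightarrow> 'a set \<Rightarrow> 'a \<Rightarrow> bool" where
  "integral_over R A x \<longleftrightarrow>
     (\<exists>p \<in> carrier (univ_poly R A). p \<noteq> [] \<and> hd p = \<one>\<^bsub>R\<^esub> \<and> ring.eval R p x = \<zero>\<^bsub>R\<^esub>)"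

text \<open>
  For a subring \<open>A\<close> of a field \<open>L\<close>, the subfield of \<open>L\<close> generated by \<open>A\<close> is the field of
  fractions of \<open>A\<close>.
\<close>

definition normalization_in :: "('a, 'b) ring_scheme \<Rightarrow> 'a set \<Rightarrow> 'a set" where
  "normalization_in L A = {x \<in> generate_field L A. integral_over L A x}"


section \<open>Subalgebras of the power series ring\<close>

abbreviation fps_ring :: "'k::field fps ring" where
  "fps_ring \<equiv> ring_of_type_algebra"

abbreviation fls_ring :: "'k::field fls ring" where
  "fls_ring \<equiv> ring_of_type_algebra"

abbreviation fps_subring :: "'k::field fps set \<Rightarrow> 'k fps ring" where
  "fps_subring A \<equiv> fps_ring\<lparr>carrier := A\<rparr>"

definition fps_subalgebra :: "'k::field fps set \<Rightarrow> bool" where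
  "fps_subalgebra A \<longleftrightarrow> subring A fps_ring \<and> range fps_const \<subseteq> A"

text \<open>
  The Laurent series field contains the fraction field of every subring \<open>A\<close> of the power
  series ring, so the normalization of \<open>A\<close> can be formed there and compared with the
  subring of all power series.
\<close>

definition has_normalization_fps :: "'k::field fps set \<Rightarrow> bool" where
  "has_normalization_fps A \<longleftrightarrow>
     normalization_in fls_ring (fps_to_fls ` A) = range fps_to_fls"

definition order_set :: "'k::field fps set \<Rightarrow> nat set" where
  "order_set I = {subdegree f | f. f \<in> I \<and> f \<noteq> 0}"

definition semigroup_module :: "nat set \<Rightarrow> nat set \<Rightarrow> bool" where
  "semigroup_module \<Gamma> S \<longleftrightarrow>
     S \<subseteq> \<Gamma> \<and> (\<forall>s1\<in>S. \<forall>s2\<in>S. s1 + s2 \<in> S) \<and> (\<forall>s\<in>S. \<forall>\<gamma>\<in>\<Gamma>. s + \<gamma> \<in> S)"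

text \<open>
  The scalars act on the quotient ring through the image of the constant power series; this
  image is a copy of the ground field unless the quotient is the zero ring, which has
  dimension \<open>0\<close> in either case.
\<close>

definition has_codimension :: "'k::field fps set \<Rightarrow> 'k fps set \<Rightarrow> nat \<Rightarrow> bool" where
  "has_codimension A I r \<longleftrightarrow>
     ring.dimension (fps_subring A Quot I) r
       (range (\<lambda>c. I +>\<^bsub>fps_subring A\<^esub> fps_const c))
       (carrier (fps_subring A Quot I))"

definition nonzero_ideals :: "'k::field fps set \<Rightarrow> 'k fps set set" where
  "nonzero_ideals A = {I. ideal I (fps_subring A) \<and> I \<noteq> {0}}"

definition ideals_of_codimension :: "'k::field fps set \<Rightarrow> nat \<Rightarrow> 'k fps set set" where
  "ideals_of_codimension A r = {I \<in> nonzero_ideals A. has_codimension A I r}"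

definition ideals_with_order_set :: "'k::field fps set \<Rightarrow> nat set \<Rightarrow> 'k fps set set" where
  "ideals_with_order_set A S = {I \<in> nonzero_ideals A. order_set I = S}"

end

theory Submission
  imports Defs
begin

text \<open>
  Filtering \<open>A/I\<close> by the order of representatives shows that the codimension of \<open>I\<close> is
  \<open>card (\<Gamma> - \<Gamma>(I))\<close>, so it depends only on the order set. If \<open>\<Gamma>\<close> contains all integers
  from \<open>c\<close> on and \<open>card (\<Gamma> - S) = r\<close>, then \<open>\<Gamma> - S\<close> lies below \<open>2c + r\<close>: for a larger
  \<open>\<gamma> \<in> \<Gamma> - S\<close>, none of the \<open>r + 1\<close> elements \<open>c, \<dots>, c + r\<close> of \<open>\<Gamma>\<close> could lie in \<open>S\<close>. Hence
  only finitely many \<open>S\<close> occur. Such a \<open>c\<close> exists because \<open>A\<close> has a nonzero conductor,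
  by completeness.
\<close>

section \<open>Power series and their filtration by order\<close>

lemma fps_ring_simps [simp]:
  "carrier (ring_of_type_algebra :: 'a::comm_ring_1 ring) = UNIV"
  "monoid.mult (ring_of_type_algebra :: 'a ring) = (*)"
  "add (ring_of_type_algebra :: 'a ring) = (+)"
  "one (ring_of_type_algebra :: 'a ring) = 1"
  "ring.zero (ring_of_type_algebra :: 'a ring) = 0"
  by (simp_all add: ring_of_type_algebra_def fun_eq_iff)

lemma ring_of_type_a_inv [simp]:
  "a_inv (ring_of_type_algebra :: 'a::comm_ring_1 ring) x = - x"
proof -
  interpret cring "ring_of_type_algebra :: 'a ring" by (rule cring_from_type_algebra)
  show ?thesis
    using minus_equality[of "- x" x] by simp
qed

text \<open>The multiples of \<open>t^n\<close>. Coefficients are used because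
  \<open>subdegree 0\<close> is \<open>0\<close> by convention, while the zero series must belong to
  every level.\<close>

definition fps_ord_ge :: "nat \<Rightarrow> 'a::zero fps set" where
  "fps_ord_ge n = {f. \<forall>i<n. f $ i = 0}"

lemma fps_ord_ge_0 [simp]: "fps_ord_ge 0 = UNIV"
  by (simp add: fps_ord_ge_def)

lemma fps_ord_ge_iff: "f \<in> fps_ord_ge n \<longleftrightarrow> f = 0 \<or> n \<le> subdegree f"
  unfolding fps_ord_ge_def
  by (auto intro: subdegree_geI nth_less_subdegree_zero)

lemma fps_ord_ge_antimono: "m \<le> n \<Longrightarrow> fps_ord_ge n \<subseteq> fps_ord_ge m"
  by (auto simp: fps_ord_ge_def)

lemma zero_in_fps_ord_ge [simp]: "0 \<in> fps_ord_ge n"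
  by (simp add: fps_ord_ge_def)

lemma fps_ord_ge_Suc: "f \<in> fps_ord_ge (Suc n) \<longleftrightarrow> f \<in> fps_ord_ge n \<and> f $ n = 0"
  by (auto simp: fps_ord_ge_def less_Suc_eq)

lemma fps_ord_ge_add: "f \<in> fps_ord_ge n \<Longrightarrow> g \<in> fps_ord_ge n \<Longrightarrow> f + g \<in> fps_ord_ge n"
  for f :: "'a::monoid_add fps"
  by (simp add: fps_ord_ge_def)

lemma fps_ord_ge_diff: "f \<in> fps_ord_ge n \<Longrightarrow> g \<in> fps_ord_ge n \<Longrightarrow> f - g \<in> fps_ord_ge n"
  for f :: "'a::group_add fps"
  by (simp add: fps_ord_ge_def)

lemma fps_ord_ge_mult:
  fixes f :: "'a::field fps"
  assumes "f \<in> fps_ord_ge m" "g \<in> fps_ord_ge n"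
  shows "f * g \<in> fps_ord_ge (m + n)"
proof (cases "f = 0 \<or> g = 0")
  case False
  then show ?thesis using assms by (auto simp: fps_ord_ge_iff)
qed auto

lemma fps_ord_ge_mult_right:
  fixes f :: "'a::field fps"
  shows "f \<in> fps_ord_ge n \<Longrightarrow> g * f \<in> fps_ord_ge n"
  using fps_ord_ge_mult[of g 0 f n] by simp

lemma eq_if_diff_in_all_fps_ord_ge:
  fixes f :: "'a::group_add fps"
  assumes "\<And>n. f - g \<in> fps_ord_ge n"
  shows "f = g"
proof (rule fps_ext)
  fix i show "f $ i = g $ i"
    using assms[of "Suc i"] by (simp add: fps_ord_ge_Suc)
qed

text \<open>Greedy elimination: a series with one prescribed order \<open>n\<close> for each
  \<open>n\<close> can always cancel the current lowest coefficient, so \<open>y\<close> behaves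
  like a topological basis.\<close>

lemma fps_expansion_exists:
  fixes y :: "nat \<Rightarrow> 'a::field fps"
  assumes y: "\<And>n. y n \<noteq> 0" "\<And>n. subdegree (y n) = n"
  shows "\<exists>c. \<forall>n. f - (\<Sum>i<n. fps_const (c i) * y i) \<in> fps_ord_ge n"
proof -
  \<comment> \<open>\<open>R n\<close> is the remainder after \<open>n\<close> cancellations; the
    chosen scalar kills its coefficient at \<open>n\<close> and leaves the lower ones zero.\<close>
  define R where "R = rec_nat f (\<lambda>n g. g - fps_const (g $ n / y n $ n) * y n)"
  define c where "c n = R n $ n / y n $ n" for n
  have R: "R 0 = f" "R (Suc n) = R n - fps_const (c n) * y n" for n
    by (simp_all add: R_def c_def)
  have nz: "y n $ n \<noteq> 0" for n
    using y[of n] nth_subdegree_nonzero[of "y n"] by simp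
  have ord: "R n \<in> fps_ord_ge n" for n
  proof (induction n)
    case (Suc n)
    have "fps_const (c n) * y n \<in> fps_ord_ge n"
      by (rule fps_ord_ge_mult_right) (simp add: fps_ord_ge_iff y)
    with Suc have "R (Suc n) \<in> fps_ord_ge n"
      by (simp add: R fps_ord_ge_diff)
    then show ?case
      using nz by (simp add: fps_ord_ge_Suc R c_def)
  qed simp
  have "R n = f - (\<Sum>i<n. fps_const (c i) * y i)" for n
    by (induction n) (simp_all add: R)
  with ord show ?thesis by auto
qed

text \<open>Serves the degenerate case of a zero quotient ring, where the scalars do not form a
  subfield. Zero persists in each line extension through the coefficient zero.\<close>

lemma (in ring) zero_mem_dimension:
  assumes "dimension n K E" "\<zero> \<in> K"
  shows "\<zero> \<in> E"
  using assms
proof (induction rule: dimension.induct)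
  case (Suc_dim v E n K)
  then have "\<zero> = \<zero> \<otimes> v \<oplus> \<zero>" by simp
  with Suc_dim show ?case unfolding line_extension_mem_iff by blast
qed simp

section \<open>Subalgebras of \<open>k[[t]]\<close>, their ideals and the maximal ideal\<close>

locale fps_subalg =
  fixes A :: "'k::field fps set"
  assumes subalg: "fps_subalgebra A"
begin

lemma A_subring: "subring A fps_ring"
  using subalg by (simp add: fps_subalgebra_def)

lemma const_in_A [simp, intro]: "fps_const c \<in> A"
  using subalg by (auto simp: fps_subalgebra_def)

lemma A_closed [simp, intro]:
  shows "0 \<in> A" "1 \<in> A"
    and "f \<in> A \<Longrightarrow> g \<in> A \<Longrightarrow> f + g \<in> A"
    and "f \<in> A \<Longrightarrow> g \<in> A \<Longrightarrow> f * g \<in> A"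
    and "f \<in> A \<Longrightarrow> - f \<in> A"
  using subringE(2,3,5,6,7)[OF A_subring] by auto

lemma A_diff [simp, intro]: "f \<in> A \<Longrightarrow> g \<in> A \<Longrightarrow> f - g \<in> A"
  using A_closed(3)[of f "- g"] by simp

lemma A_power [simp, intro]: "f \<in> A \<Longrightarrow> f ^ n \<in> A"
  by (induction n) auto

lemma A_sum [intro]: "(\<And>i. i \<in> J \<Longrightarrow> f i \<in> A) \<Longrightarrow> sum f J \<in> A"
  by (induction J rule: infinite_finite_induct) auto

sublocale A: cring "fps_subring A"
proof -
  interpret F: cring "fps_ring :: 'k fps ring" by (rule cring_from_type_algebra)
  show "cring (fps_subring A)"
    by (rule F.subcring_iff[THEN iffD1, OF _ F.subcringI'[OF A_subring]]) simp
qed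

lemma a_inv_A: "f \<in> A \<Longrightarrow> \<ominus>\<^bsub>fps_subring A\<^esub> f = - f"
  using A.minus_equality[of "- f" f] by simp

lemma a_minus_A: "f \<in> A \<Longrightarrow> g \<in> A \<Longrightarrow> f \<ominus>\<^bsub>fps_subring A\<^esub> g = f - g"
  by (simp add: a_minus_def a_inv_A)

lemma idealI_A:
  assumes "I \<subseteq> A" "0 \<in> I"
    and add: "\<And>f g. f \<in> I \<Longrightarrow> g \<in> I \<Longrightarrow> f + g \<in> I"
    and mult: "\<And>f g. f \<in> I \<Longrightarrow> g \<in> A \<Longrightarrow> g * f \<in> I"
  shows "ideal I (fps_subring A)"
proof (rule idealI)
  have neg: "- f \<in> I" if "f \<in> I" for f
    using mult[OF that, of "-1"] by simp
  show "subgroup I (add_monoid (fps_subring A))"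
    by (rule A.add.subgroupI)
       (use assms in \<open>auto simp flip: a_inv_def simp: a_inv_A subset_iff neg\<close>)
qed (use assms in \<open>auto simp: A.ring_axioms mult.commute\<close>)

context
  fixes I assumes I: "ideal I (fps_subring A)"
begin

lemma ideal_subset_A: "I \<subseteq> A"
  using ideal.Icarr[OF I] by auto

lemma ideal_closed:
  shows "0 \<in> I"
    and "f \<in> I \<Longrightarrow> g \<in> I \<Longrightarrow> f + g \<in> I"
    and "f \<in> I \<Longrightarrow> g \<in> A \<Longrightarrow> g * f \<in> I"
  using additive_subgroup.zero_closed[OF ideal.axioms(1)[OF I]]
    additive_subgroup.a_closed[OF ideal.axioms(1)[OF I], of f g]
    ideal.I_l_closed[OF I, of f g] by auto

lemma ideal_diff:
  assumes "f \<in> I" "g \<in> I" shows "f - g \<in> I"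
  using ideal_closed(2)[OF assms(1) ideal_closed(3)[OF assms(2), of "-1"]] by simp

lemma ideal_sum: "(\<And>i. i \<in> J \<Longrightarrow> f i \<in> I) \<Longrightarrow> sum f J \<in> I"
  by (induction J rule: infinite_finite_induct) (auto intro: ideal_closed)

end

definition M :: "'k fps set" where "M = {f \<in> A. f $ 0 = 0}"

lemma M_ideal: "ideal M (fps_subring A)"
  by (rule idealI_A) (auto simp: M_def)

text \<open>An element outside \<open>M\<close> is congruent modulo \<open>M\<close> to its constant
  term, a nonzero scalar and hence a unit of \<open>A\<close>; an ideal properly above
  \<open>M\<close> therefore contains \<open>1\<close>.\<close>

lemma M_maximal: "maximalideal M (fps_subring A)"
proof (rule maximalidealI[OF M_ideal])
  have "1 \<in> A" "1 \<notin> M" by (auto simp: M_def)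
  then show "carrier (fps_subring A) \<noteq> M" by auto
next
  fix J assume J: "ideal J (fps_subring A)" "M \<subseteq> J" "J \<subseteq> carrier (fps_subring A)"
  have "A \<subseteq> J" if "J \<noteq> M"
  proof -
    obtain f where f: "f \<in> J" "f \<notin> M" using J(2) \<open>J \<noteq> M\<close> by blast
    then have fA: "f \<in> A" "f $ 0 \<noteq> 0" using J by (auto simp: M_def)
    have "f - fps_const (f $ 0) \<in> M" using fA by (auto simp: M_def)
    then have "f - fps_const (f $ 0) \<in> J" using J(2) by blast
    then have "f - (f - fps_const (f $ 0)) \<in> J" by (rule ideal_diff[OF J(1) f(1)])
    then have "fps_const (f $ 0) \<in> J" by simp
    then have "fps_const (inverse (f $ 0)) * fps_const (f $ 0) \<in> J"
      using J by (intro ideal_closed(3)) auto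
    then have "1 \<in> J" using fA by simp
    then show ?thesis using ideal_closed(3)[OF J(1), of 1] by auto
  qed
  then show "J = M \<or> J = carrier (fps_subring A)" using J by auto
qed

lemma max_ideal_eq:
  assumes "local_ring (fps_subring A)"
  shows "max_ideal (fps_subring A) = M"
  unfolding max_ideal_def using assms M_maximal
  by (auto simp: local_ring_def intro!: the1_equality)

abbreviation Mpow :: "nat \<Rightarrow> 'k fps set" where
  "Mpow n \<equiv> ideal_power (fps_subring A) M n"

lemma Mpow_0: "Mpow 0 = A"
  by (simp add: ideal_power_def ideals_set_def nat_pow_def)

lemma Mpow_Suc: "Mpow (Suc n) = ideal_prod (fps_subring A) (Mpow n) M"
  by (simp add: ideal_power_def ideals_set_def nat_pow_def)

lemma Mpow_ideal: "ideal (Mpow n) (fps_subring A)"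
proof (induction n)
  case 0
  show ?case using A.oneideal by (simp add: Mpow_0)
next
  case (Suc n)
  then show ?case by (simp add: Mpow_Suc A.ideal_prod_is_ideal M_ideal)
qed

text \<open>Elements of \<open>M\<close> have order at least \<open>1\<close> and orders add under
  products. Thus adic convergence in \<open>A\<close> implies coefficientwise convergence.\<close>

lemma Mpow_subset_fps_ord_ge: "Mpow n \<subseteq> fps_ord_ge n"
proof (induction n)
  case (Suc n)
  show ?case
  proof
    fix f assume "f \<in> Mpow (Suc n)"
    then show "f \<in> fps_ord_ge (Suc n)"
      unfolding Mpow_Suc
    proof (induction f rule: ideal_prod.induct)
      case (prod i j)
      have "j \<in> fps_ord_ge 1" using prod by (auto simp: M_def fps_ord_ge_def)
      with prod Suc show ?case using fps_ord_ge_mult[of i n j 1] by auto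
    qed (simp add: fps_ord_ge_add)
  qed
qed simp

lemma power_in_Mpow: "f \<in> M \<Longrightarrow> f ^ n \<in> Mpow n"
proof (induction n)
  case (Suc n)
  then show ?case
    using ideal_prod.prod[of "f ^ n" "Mpow n" f M "fps_subring A"]
    by (simp add: Mpow_Suc mult.commute)
qed (simp add: Mpow_0)

lemma Mpow_antimono: "m \<le> n \<Longrightarrow> Mpow n \<subseteq> Mpow m"
proof (rule lift_Suc_antimono_le[of Mpow])
  fix n show "Mpow (Suc n) \<subseteq> Mpow n"
    using A.ideal_prod_inter[OF Mpow_ideal M_ideal] by (auto simp: Mpow_Suc)
qed

section \<open>Completeness, fractions and the conductor\<close>

lemma adic_series_converges:
  fixes h :: "nat \<Rightarrow> 'k fps" and k :: "nat \<Rightarrow> nat"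
  assumes complete: "complete_local_ring (fps_subring A)"
    and h: "\<And>n. h n \<in> Mpow (k n)"
    and k: "filterlim k at_top at_top"
  shows "\<exists>y\<in>A. \<forall>n. \<exists>N. \<forall>i\<ge>N. (\<Sum>j<i. h j) - y \<in> fps_ord_ge n"
proof -
  let ?s = "\<lambda>i. \<Sum>j<i. h j"
  have max: "max_ideal (fps_subring A) = M"
    using complete by (intro max_ideal_eq) (simp add: complete_local_ring_def)
  have hA: "h n \<in> A" for n using h ideal_subset_A[OF Mpow_ideal] by blast
  then have sA: "?s i \<in> A" for i by (rule A_sum)
  have "\<exists>N. \<forall>i\<ge>N. \<forall>j\<ge>N. ?s i - ?s j \<in> Mpow n" for n
  proof -
    obtain N where N: "\<And>i. i \<ge> N \<Longrightarrow> k i \<ge> n"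
      using k by (auto simp: filterlim_at_top eventually_at_top_linorder)
    \<comment> \<open>Beyond \<open>N\<close> every term lies in \<open>Mpow n\<close>, so a tail
      sum does too; two late partial sums are compared through the one at \<open>N\<close>.\<close>
    have *: "?s i - ?s N \<in> Mpow n" if "i \<ge> N" for i
    proof -
      have "?s i - ?s N = sum h {N..<i}"
        using sum_diff_nat_ivl[of 0 N i h] that by (simp add: lessThan_atLeast0)
      also have "\<dots> \<in> Mpow n"
        using h N Mpow_antimono by (intro ideal_sum[OF Mpow_ideal]) (metis atLeastLessThan_iff subsetD)
      finally show ?thesis .
    qed
    have "?s i - ?s j \<in> Mpow n" if "i \<ge> N" "j \<ge> N" for i j
      using ideal_diff[OF Mpow_ideal *[OF that(1)] *[OF that(2)]] by simp
    then show ?thesis by blast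
  qed
  then have "adic_cauchy (fps_subring A) (max_ideal (fps_subring A)) ?s"
    by (simp add: adic_cauchy_def max sA a_minus_A)
  then obtain y where "adic_tendsto (fps_subring A) M ?s y"
    using complete by (auto simp: complete_local_ring_def max)
  then have "y \<in> A" "\<forall>n. \<exists>N. \<forall>i\<ge>N. ?s i - y \<in> Mpow n"
    by (auto simp: adic_tendsto_def a_minus_A sA)
  \<comment> \<open>The limit is passed on in the order topology, where it can be compared with
    series not known to lie in \<open>A\<close>.\<close>
  then show ?thesis
    using Mpow_subset_fps_ord_ge by blast
qed

text \<open>Fractions with numerator and denominator in \<open>A\<close> are closed under the field
  operations. The equation is cross-multiplied so that it can later be read back in the power series
  ring.\<close>

lemma generate_field_fractions:
  assumes "h \<in> generate_field fls_ring (fps_to_fls ` A)"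
  shows "\<exists>a\<in>A. \<exists>b\<in>A. b \<noteq> 0 \<and> fps_to_fls b * h = fps_to_fls a"
  using assms
proof (induction rule: generate_field.induct)
  case one
  show ?case by (intro bexI[of _ 1]) auto
next
  case (incl h)
  then obtain a where "a \<in> A" "h = fps_to_fls a" by auto
  then show ?case by (intro bexI[of _ a] bexI[of _ 1]) auto
next
  case (a_inv h)
  then obtain a b where "a \<in> A" "b \<in> A" "b \<noteq> 0" "fps_to_fls b * h = fps_to_fls a" by auto
  then show ?case by (intro bexI[of _ "- a"] bexI[of _ b]) auto
next
  case (m_inv h)
  then obtain a b where ab: "a \<in> A" "b \<in> A" "b \<noteq> 0" "fps_to_fls b * h = fps_to_fls a" by auto
  interpret L: field "fls_ring :: 'k fls ring" by (rule field_from_type_algebra)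
  have "h \<in> Units (fls_ring :: 'k fls ring)" using m_inv by (simp add: L.field_Units)
  then have inv: "h * inv\<^bsub>fls_ring\<^esub> h = 1" using L.Units_r_inv by fastforce
  have "a \<noteq> 0" using ab m_inv by auto
  moreover have "fps_to_fls a * inv\<^bsub>fls_ring\<^esub> h = fps_to_fls b"
    using inv ab by (metis mult.assoc mult.right_neutral)
  ultimately show ?case using ab by blast
next
  case (eng_add h1 h2)
  then obtain a1 b1 a2 b2 where ab: "a1 \<in> A" "b1 \<in> A" "b1 \<noteq> 0" "fps_to_fls b1 * h1 = fps_to_fls a1"
    "a2 \<in> A" "b2 \<in> A" "b2 \<noteq> 0" "fps_to_fls b2 * h2 = fps_to_fls a2" by auto
  have "fps_to_fls (b1 * b2) * (h1 + h2)
      = fps_to_fls b2 * (fps_to_fls b1 * h1) + fps_to_fls b1 * (fps_to_fls b2 * h2)"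
    by (simp add: fls_times_fps_to_fls algebra_simps)
  also have "\<dots> = fps_to_fls (b2 * a1 + b1 * a2)" by (simp add: ab fls_times_fps_to_fls)
  finally show ?case
    using ab by (intro bexI[of _ "b2 * a1 + b1 * a2"] bexI[of _ "b1 * b2"]) auto
next
  case (eng_mult h1 h2)
  then obtain a1 b1 a2 b2 where ab: "a1 \<in> A" "b1 \<in> A" "b1 \<noteq> 0" "fps_to_fls b1 * h1 = fps_to_fls a1"
    "a2 \<in> A" "b2 \<in> A" "b2 \<noteq> 0" "fps_to_fls b2 * h2 = fps_to_fls a2" by auto
  have "fps_to_fls (b1 * b2) * (h1 * h2)
      = (fps_to_fls b1 * h1) * (fps_to_fls b2 * h2)"
    by (simp add: fls_times_fps_to_fls algebra_simps)
  also have "\<dots> = fps_to_fls (a1 * a2)" by (simp add: ab fls_times_fps_to_fls)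
  finally show ?case
    using ab by (intro bexI[of _ "a1 * a2"] bexI[of _ "b1 * b2"]) auto
qed

lemma normalization_fraction:
  assumes "has_normalization_fps A"
  obtains a b where "a \<in> A" "b \<in> A" "b \<noteq> 0" "b * f = a"
proof -
  have "fps_to_fls f \<in> generate_field fls_ring (fps_to_fls ` A)"
    using assms by (auto simp: has_normalization_fps_def normalization_in_def)
  then obtain a b where "a \<in> A" "b \<in> A" "b \<noteq> 0" "fps_to_fls b * fps_to_fls f = fps_to_fls a"
    using generate_field_fractions by blast
  then show ?thesis
    using that[of a b] by (simp flip: fls_times_fps_to_fls)
qed

text \<open>If \<open>M\<close> were zero, \<open>A\<close> would consist of constants only, and
  \<open>t\<close> could not be a fraction of elements of \<open>A\<close>.\<close>

lemma exists_nonzero_in_M: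
  assumes "has_normalization_fps A"
  obtains x where "x \<in> M" "x \<noteq> 0"
proof -
  have "\<exists>x\<in>M. x \<noteq> 0"
  proof (rule ccontr)
    assume "\<not> (\<exists>x\<in>M. x \<noteq> 0)"
    then have M0: "f = 0" if "f \<in> M" for f using that by blast
    have const: "f = fps_const (f $ 0)" if "f \<in> A" for f
      using M0[of "f - fps_const (f $ 0)"] that by (auto simp: M_def)
    obtain a b where ab: "a \<in> A" "b \<in> A" "b \<noteq> 0" "b * fps_X = a"
      using normalization_fraction[OF assms] by blast
    \<comment> \<open>Compare the coefficients of \<open>t\<close> in \<open>b * t = a\<close>,
      where \<open>a\<close> is constant; this forces the constant \<open>b\<close> to
      vanish.\<close>
    have "a $ 1 = 0" "a $ 1 = b $ 0"
      using arg_cong[OF const[OF ab(1)], of "\<lambda>f. f $ 1"] ab(4) by auto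
    then show False using const[OF ab(2)] ab(3) by (metis fps_const_0_eq_0)
  qed
  with that show thesis by blast
qed

text \<open>
  The conductor: with \<open>x\<close> in the maximal ideal of order \<open>e > 0\<close>, the series \<open>t\<^bsup>n mod e\<^esup> x\<^bsup>n div e\<^esup>\<close> has order exactly \<open>n\<close>,
  so every power series is a combination of these. Multiplying by a common denominator of
  \<open>1, t, \<dots>, t\<^bsup>e-1\<^esup>\<close> turns the partial sums into an adic Cauchy sequence in \<open>A\<close>.
\<close>

lemma exists_common_denominator:
  assumes complete: "complete_local_ring (fps_subring A)"
    and norm: "has_normalization_fps A"
  obtains b where "b \<in> A" "b \<noteq> 0" "\<And>f. b * f \<in> A"
proof -
  obtain x where x: "x \<in> M" "x \<noteq> 0" using exists_nonzero_in_M[OF norm] by blast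
  define e where "e = subdegree x"
  have e: "e > 0" using x by (auto simp: e_def M_def subdegree_eq_0_iff intro!: Nat.gr0I)
  obtain a b where ab: "a \<in> A" "b \<in> A" "b \<noteq> 0" "b * fps_X = a"
    using normalization_fraction[OF norm] by blast
  \<comment> \<open>One factor \<open>b\<close> turns one factor \<open>t\<close> into the element
    \<open>a\<close> of \<open>A\<close>, so \<open>e\<close> factors suffice for all
    \<open>t^i\<close> with \<open>i < e\<close>.\<close>
  define B where "B = b ^ e"
  have B: "B \<in> A" "B \<noteq> 0" using ab by (auto simp: B_def)
  have BX: "B * fps_X ^ i \<in> A" if "i < e" for i
  proof -
    have "B * fps_X ^ i = b ^ (e - i) * (b * fps_X) ^ i"
      using that by (simp add: B_def power_mult_distrib flip: power_add mult.assoc)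
    then show ?thesis using ab by auto
  qed
  define y where "y n = fps_X ^ (n mod e) * x ^ (n div e)" for n
  have y: "y n \<noteq> 0" "subdegree (y n) = n" for n
    using x by (simp_all add: y_def flip: e_def)
  have "B * f \<in> A" for f
  proof -
    obtain c where c: "\<And>n. f - (\<Sum>i<n. fps_const (c i) * y i) \<in> fps_ord_ge n"
      using fps_expansion_exists[of y f] y by blast
    define h where "h n = fps_const (c n) * (B * y n)" for n
    \<comment> \<open>\<open>B\<close> brings the factor \<open>t^(n mod e)\<close> into
      \<open>A\<close>, and the power of \<open>x\<close> supplies the membership in
      \<open>Mpow (n div e)\<close>.\<close>
    have "h n \<in> Mpow (n div e)" for n
    proof -
      have "fps_const (c n) * (B * fps_X ^ (n mod e)) * x ^ (n div e) \<in> Mpow (n div e)"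
        using BX[of "n mod e"] e x by (intro ideal_closed(3)[OF Mpow_ideal] power_in_Mpow) auto
      then show ?thesis by (simp add: h_def y_def mult.assoc)
    qed
    moreover have "filterlim (\<lambda>n. n div e) at_top at_top"
      using e by (rule filterlim_at_top_div_const_nat)
    ultimately obtain z where z: "z \<in> A" "\<And>n. \<exists>N. \<forall>i\<ge>N. (\<Sum>j<i. h j) - z \<in> fps_ord_ge n"
      using adic_series_converges[OF complete, of h "\<lambda>n. n div e"] by blast
    have "B * f = z"
    proof (rule eq_if_diff_in_all_fps_ord_ge)
      fix n
      obtain N where N: "\<And>i. i \<ge> N \<Longrightarrow> (\<Sum>j<i. h j) - z \<in> fps_ord_ge n" using z by blast
      define i where "i = max N n"
      \<comment> \<open>The partial sums of \<open>h\<close> are \<open>B\<close> times those of the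
        expansion of \<open>f\<close>, so they tend to \<open>B * f\<close> as well as to
        \<open>z\<close>; both errors are small once \<open>i\<close> exceeds \<open>N\<close> and
        \<open>n\<close>.\<close>
      have "B * (f - (\<Sum>j<i. fps_const (c j) * y j)) \<in> fps_ord_ge i"
        by (intro fps_ord_ge_mult_right c)
      then have "B * f - (\<Sum>j<i. h j) \<in> fps_ord_ge n"
        using fps_ord_ge_antimono[of n i]
        by (auto simp: h_def i_def right_diff_distrib sum_distrib_left mult_ac)
      from fps_ord_ge_add[OF this N[of i]] show "B * f - z \<in> fps_ord_ge n"
        by (simp add: i_def)
    qed
    with z show ?thesis by simp
  qed
  with B that show ?thesis by blast
qed

text \<open>In \<open>k[[t]]\<close> divisibility is decided by order, so
  \<open>f = (b * h) * g\<close>; the factor \<open>b * h\<close> lies in \<open>A\<close> although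
  \<open>h\<close> need not.\<close>

lemma ideal_contains_high_order:
  assumes b: "b \<noteq> 0" "\<And>f. b * f \<in> A"
    and I: "ideal I (fps_subring A)" and g: "g \<in> I" "g \<noteq> 0"
  shows "fps_ord_ge (subdegree b + subdegree g) \<subseteq> I"
proof
  fix f :: "'k fps" assume f: "f \<in> fps_ord_ge (subdegree b + subdegree g)"
  have "b * g dvd f"
  proof (cases "f = 0")
    case False
    then show ?thesis using f b g by (simp add: fps_ord_ge_iff fps_dvd_iff)
  qed simp
  then obtain h where "f = (b * h) * g" by (auto simp: dvd_def mult_ac)
  then show "f \<in> I" using ideal_closed(3)[OF I g(1) b(2)] by simp
qed


section \<open>Order sets of ideals\<close>

lemma order_set_semigroup_module:
  assumes I: "ideal I (fps_subring A)"
  shows "semigroup_module (order_set A) (order_set I)"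
proof -
  have sub: "order_set I \<subseteq> order_set A"
    using ideal_subset_A[OF I] by (auto simp: order_set_def)
  moreover have "s + \<gamma> \<in> order_set I" if s: "s \<in> order_set I" and \<gamma>: "\<gamma> \<in> order_set A" for s \<gamma>
  proof -
    obtain f g where fg: "f \<in> I" "f \<noteq> 0" "s = subdegree f" "g \<in> A" "g \<noteq> 0" "\<gamma> = subdegree g"
      using s \<gamma> by (auto simp: order_set_def)
    then have "g * f \<in> I" "g * f \<noteq> 0" "subdegree (g * f) = s + \<gamma>"
      using ideal_closed(3)[OF I] by auto
    then show ?thesis unfolding order_set_def by force
  qed
  \<comment> \<open>Closure of the order set under its own addition is the case where \<gamma>
    itself is the order of an element of \<open>I\<close>, as \<open>I\<close> lies in
    \<open>A\<close>.\<close>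
  ultimately show ?thesis by (auto simp: semigroup_module_def)
qed

lemma order_set_iff: "n \<in> order_set I \<longleftrightarrow> (\<exists>f\<in>I. f \<in> fps_ord_ge n \<and> f $ n \<noteq> 0)"
proof
  assume "n \<in> order_set I"
  then obtain f where "f \<in> I" "f \<noteq> 0" "n = subdegree f" by (auto simp: order_set_def)
  then show "\<exists>f\<in>I. f \<in> fps_ord_ge n \<and> f $ n \<noteq> 0" by (auto simp: fps_ord_ge_iff)
next
  assume "\<exists>f\<in>I. f \<in> fps_ord_ge n \<and> f $ n \<noteq> 0"
  then obtain f where f: "f \<in> I" "f \<in> fps_ord_ge n" "f $ n \<noteq> 0" by blast
  then have "subdegree f = n" by (intro subdegreeI) (auto simp: fps_ord_ge_def)
  with f show "n \<in> order_set I" by (auto simp: order_set_def)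
qed

lemma fps_ord_ge_subset_imp_order_set:
  assumes "fps_ord_ge N \<subseteq> (I :: 'k fps set)"
  shows "{N..} \<subseteq> order_set I"
proof
  fix n assume "n \<in> {N..}"
  then have "fps_X ^ n \<in> I" using assms by (auto simp: fps_ord_ge_iff)
  then show "n \<in> order_set I" unfolding order_set_def by (intro CollectI exI[of _ "fps_X ^ n"]) auto
qed

section \<open>Codimension as the number of gaps\<close>

context
  fixes I and N :: nat
  assumes I: "ideal I (fps_subring A)" and N: "fps_ord_ge N \<subseteq> I"
begin

abbreviation Q :: "'k fps set ring" where "Q \<equiv> fps_subring A Quot I"
abbreviation cls :: "'k fps \<Rightarrow> 'k fps set" where "cls f \<equiv> I +>\<^bsub>fps_subring A\<^esub> f"
abbreviation gaps :: "nat set" where "gaps \<equiv> order_set A - order_set I"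

lemma cls_hom: "ring_hom_ring (fps_subring A) Q cls"
  using ideal.rcos_ring_hom_ring[OF I] .

lemma cls_eq_iff: "f \<in> A \<Longrightarrow> g \<in> A \<Longrightarrow> cls f = cls g \<longleftrightarrow> f - g \<in> I"
  using A.quotient_eq_iff_same_a_r_cos[OF I, of f g] by (simp add: a_minus_A)

lemma cls_add: "f \<in> A \<Longrightarrow> g \<in> A \<Longrightarrow> cls (f + g) = cls f \<oplus>\<^bsub>Q\<^esub> cls g"
  using ring_hom_ring.homh[OF cls_hom] ring_hom_add[of cls "fps_subring A" Q f g] by simp

lemma cls_mult: "f \<in> A \<Longrightarrow> g \<in> A \<Longrightarrow> cls (f * g) = cls f \<otimes>\<^bsub>Q\<^esub> cls g"
  using ring_hom_ring.homh[OF cls_hom] ring_hom_mult[of cls "fps_subring A" Q f g] by simp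

lemma cls_in_carrier: "f \<in> A \<Longrightarrow> cls f \<in> carrier Q"
  using ring_hom_ring.homh[OF cls_hom] ring_hom_closed[of cls "fps_subring A" Q f] by simp

lemma carrier_Q: "carrier Q = cls ` A"
  by (auto simp: FactRing_def A_RCOSETS_defs a_r_coset_def)

lemma cls_0: "cls 0 = \<zero>\<^bsub>Q\<^esub>"
  using ring_hom_ring.homh[OF cls_hom] ring_hom_zero[of cls "fps_subring A" Q]
    A.ring_axioms ideal.quotient_is_ring[OF I] by simp

lemma constants_subfield: "subfield (range fps_const) (fps_subring A)"
proof (rule A.subfieldI)
  have "subring (range fps_const) (fps_subring A)"
  proof (rule A.subringI)
    fix h assume "h \<in> range (fps_const :: 'k \<Rightarrow> 'k fps)"
    then show "\<ominus>\<^bsub>fps_subring A\<^esub> h \<in> range fps_const" by (auto simp: a_inv_A)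
  qed (auto simp flip: fps_const_1_eq_1)
  then show "subcring (range fps_const) (fps_subring A)" by (rule A.subcringI')
  have "fps_const c * fps_const (inverse c) = 1" "fps_const (inverse c) * fps_const c = 1"
    if "c \<noteq> 0" for c :: 'k
    using that by simp_all
  then show "Units (fps_subring A\<lparr>carrier := range fps_const\<rparr>)
      = range fps_const - {\<zero>\<^bsub>fps_subring A\<^esub>}"
    by (fastforce simp: Units_def)
qed

text \<open>The quotient is filtered by the images \<open>E n\<close> of the elements of order at
  least \<open>n\<close>. Going down from \<open>E N = 0\<close> to \<open>E 0\<close>, the
  dimension grows by one exactly at each gap.\<close>

lemma has_codimension_card_gaps: "has_codimension A I (card gaps)"
proof -
  interpret Q: ring Q by (rule ideal.quotient_is_ring[OF I])
  let ?K = "range (\<lambda>c. cls (fps_const c))"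
  define E where "E n = cls ` (A \<inter> fps_ord_ge n)" for n
  have step_gap: "Q.dimension (Suc d) ?K (E n)"
    if n: "n \<in> gaps" and dim: "Q.dimension d ?K (E (Suc n))" for n d
  proof -
    obtain f where f: "f \<in> A" "f \<in> fps_ord_ge n" "f $ n \<noteq> 0"
      using n by (auto simp: order_set_iff)
    \<comment> \<open>If \<open>f\<close> were congruent to some \<open>g\<close> of higher order,
      \<open>f - g\<close> would be an element of \<open>I\<close> of order \<open>n\<close>, so
      \<open>n\<close> would be no gap.\<close>
    have "cls f \<notin> E (Suc n)"
    proof
      assume "cls f \<in> E (Suc n)"
      then obtain g where g: "g \<in> A" "g \<in> fps_ord_ge (Suc n)" "cls f = cls g" by (auto simp: E_def)
      then have "f - g \<in> I" "f - g \<in> fps_ord_ge n" "(f - g) $ n \<noteq> 0"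
        using f by (simp_all add: cls_eq_iff fps_ord_ge_Suc fps_ord_ge_diff)
      then show False using n by (auto simp: order_set_iff)
    qed
    with dim have "Q.dimension (Suc d) ?K (Q.line_extension ?K (cls f) (E (Suc n)))"
      using f by (intro Q.Suc_dim cls_in_carrier)
    also have "Q.line_extension ?K (cls f) (E (Suc n)) = E n"
    proof (rule Set.set_eqI, rule iffI)
      fix u assume "u \<in> Q.line_extension ?K (cls f) (E (Suc n))"
      then obtain c g where "g \<in> A" "g \<in> fps_ord_ge (Suc n)"
        "u = cls (fps_const c) \<otimes>\<^bsub>Q\<^esub> cls f \<oplus>\<^bsub>Q\<^esub> cls g"
        by (auto simp: Q.line_extension_mem_iff E_def)
      with f have "u = cls (fps_const c * f + g)" "fps_const c * f + g \<in> A"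
        "fps_const c * f + g \<in> fps_ord_ge n"
        by (auto simp: cls_add cls_mult fps_ord_ge_Suc intro!: fps_ord_ge_add fps_ord_ge_mult_right)
      then show "u \<in> E n" by (auto simp: E_def)
    next
      fix u assume "u \<in> E n"
      then obtain g where g: "g \<in> A" "g \<in> fps_ord_ge n" "u = cls g" by (auto simp: E_def)
      \<comment> \<open>This scalar cancels the coefficient of \<open>g\<close> at \<open>n\<close>,
        so that the remainder lies one level higher.\<close>
      define c where "c = g $ n / f $ n"
      define g' where "g' = g - fps_const c * f"
      have "g' \<in> A" "g' \<in> fps_ord_ge (Suc n)"
        using f g by (auto simp: g'_def c_def fps_ord_ge_Suc intro!: fps_ord_ge_diff fps_ord_ge_mult_right)
      moreover have "u = cls (fps_const c) \<otimes>\<^bsub>Q\<^esub> cls f \<oplus>\<^bsub>Q\<^esub> cls g'"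
        using f g \<open>g' \<in> A\<close> by (simp add: g'_def flip: cls_add cls_mult)
      ultimately show "u \<in> Q.line_extension ?K (cls f) (E (Suc n))"
        unfolding Q.line_extension_mem_iff E_def by blast
    qed
    finally show ?thesis .
  qed
  have step_no_gap: "E n = E (Suc n)" if n: "n \<notin> gaps" for n
  proof
    show "E n \<subseteq> E (Suc n)"
    proof
      fix u assume "u \<in> E n"
      then obtain g where g: "g \<in> A" "g \<in> fps_ord_ge n" "u = cls g" by (auto simp: E_def)
      \<comment> \<open>When \<open>g\<close> has order exactly \<open>n\<close>, this
        \<open>n\<close> is in \<open>order_set A\<close> and, being no gap, also in
        \<open>order_set I\<close>. Subtracting an element of \<open>I\<close> with the same leading
        term raises the order without changing the class.\<close>
      obtain i where i: "i \<in> I" "g - i \<in> fps_ord_ge (Suc n)"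
      proof (cases "g $ n = 0")
        case True
        then show ?thesis
          using that[of 0] g ideal_closed(1)[OF I] by (simp add: fps_ord_ge_Suc)
      next
        case False
        then have "n \<in> order_set I" using g n by (auto simp: order_set_iff)
        then obtain f where f: "f \<in> I" "f \<in> fps_ord_ge n" "f $ n \<noteq> 0" by (auto simp: order_set_iff)
        show ?thesis
        proof (rule that)
          show "fps_const (g $ n / f $ n) * f \<in> I" using f by (intro ideal_closed(3)[OF I]) auto
          show "g - fps_const (g $ n / f $ n) * f \<in> fps_ord_ge (Suc n)"
            using f g by (auto simp: fps_ord_ge_Suc intro!: fps_ord_ge_diff fps_ord_ge_mult_right)
        qed
      qed
      have "i \<in> A" using i ideal_subset_A[OF I] by blast
      with i g have "u = cls (g - i)" by (simp add: cls_eq_iff)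
      with i g \<open>i \<in> A\<close> show "u \<in> E (Suc n)" by (auto simp: E_def)
    qed
    show "E (Suc n) \<subseteq> E n" by (auto simp: E_def fps_ord_ge_Suc)
  qed
  have gaps_lt: "gaps \<subseteq> {..<N}"
    using fps_ord_ge_subset_imp_order_set[OF N] by (auto simp: subset_eq)
  have "Q.dimension (card (gaps \<inter> {n..})) ?K (E n)" if "n \<le> N" for n
    using that
  proof (induction n rule: inc_induct)
    case base
    have "cls f = \<zero>\<^bsub>Q\<^esub>" if "f \<in> A" "f \<in> fps_ord_ge N" for f
      using that N cls_eq_iff[of f 0] by (auto simp: cls_0)
    then have "E N = {\<zero>\<^bsub>Q\<^esub>}"
      using cls_0 by (auto simp: E_def intro!: image_eqI[of _ _ 0])
    moreover have "gaps \<inter> {N..} = {}" using gaps_lt by auto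
    ultimately show ?case using Q.zero_dim by simp
  next
    case (step n)
    show ?case
    proof (cases "n \<in> gaps")
      case True
      have "gaps \<inter> {n..} = insert n (gaps \<inter> {Suc n..})"
        using True by (auto simp: Suc_le_eq le_less)
      moreover have "finite (gaps \<inter> {Suc n..})"
        using finite_subset[OF gaps_lt] by auto
      ultimately show ?thesis using step_gap[OF True step.IH] by simp
    next
      case False
      then have "gaps \<inter> {n..} = gaps \<inter> {Suc n..}"
        by (auto simp: Suc_le_eq le_less)
      then show ?thesis using step_no_gap[OF False] step.IH by simp
    qed
  qed
  from this[of 0] show ?thesis
    by (simp add: has_codimension_def E_def carrier_Q atLeast_0)
qed

text \<open>Dimension is a relation, so its value must be shown unique. Over a subfield this is a
  standard fact; the image of the constants is one unless the quotient is zero.\<close>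

lemma has_codimension_unique:
  assumes "has_codimension A I r"
  shows "r = card gaps"
proof -
  interpret Q: ring Q by (rule ideal.quotient_is_ring[OF I])
  interpret h: ring_hom_ring "fps_subring A" Q cls by (rule cls_hom)
  let ?K = "range (\<lambda>c. cls (fps_const c))"
  have dims: "Q.dimension r ?K (carrier Q)" "Q.dimension (card gaps) ?K (carrier Q)"
    using assms has_codimension_card_gaps by (simp_all add: has_codimension_def)
  show ?thesis
  proof (cases "\<one>\<^bsub>Q\<^esub> = \<zero>\<^bsub>Q\<^esub>")
    case False
    have "subfield (range fps_const) (fps_subring A)"
      by (rule constants_subfield)
    then have "subfield ?K Q"
      using h.img_is_subfield(2)[OF _ False, of "range fps_const"] by (simp add: image_image)
    then show ?thesis using Q.dimension_is_inj dims by blast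
  next
    case True
    then have "carrier Q = {\<zero>\<^bsub>Q\<^esub>}" by (rule Q.one_zeroD)
    have "\<zero>\<^bsub>Q\<^esub> \<in> ?K" using cls_0 by (auto intro: image_eqI[of _ _ 0])
    \<comment> \<open>A positive dimension would need a vector outside a subspace containing zero,
      but zero is the only vector.\<close>
    have "d = 0" if "Q.dimension d ?K (carrier Q)" for d
      using that
    proof (cases rule: Q.dimension.cases)
      case (Suc_dim v E n)
      then show ?thesis
        using Q.zero_mem_dimension[OF _ \<open>\<zero>\<^bsub>Q\<^esub> \<in> ?K\<close>] \<open>carrier Q = {\<zero>\<^bsub>Q\<^esub>}\<close> by (metis singletonD)
    qed simp
    from this[OF dims(1)] this[OF dims(2)] show ?thesis by simp
  qed
qed

end

end

section \<open>Finitely many order sets for a given codimension\<close>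

lemma semigroup_module_gaps_bounded:
  fixes \<Gamma> S :: "nat set"
  assumes S: "semigroup_module \<Gamma> S" and c: "{c..} \<subseteq> \<Gamma>" and fin: "finite (\<Gamma> - S)"
  shows "\<Gamma> - S \<subseteq> {..<2 * c + card (\<Gamma> - S)}"
proof
  fix \<gamma> assume \<gamma>: "\<gamma> \<in> \<Gamma> - S"
  show "\<gamma> \<in> {..<2 * c + card (\<Gamma> - S)}"
  proof (rule ccontr)
    assume "\<gamma> \<notin> {..<2 * c + card (\<Gamma> - S)}"
    then have large: "\<gamma> \<ge> 2 * c + card (\<Gamma> - S)" by simp
    \<comment> \<open>For such \<delta> the difference \<gamma> - \<delta> is at least
      \<open>c\<close>, hence in \<Gamma>; were \<delta> in \<open>S\<close>, so would be \<gamma>.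
      The interval has one element more than \<Gamma> - \<open>S\<close>.\<close>
    have "{c..c + card (\<Gamma> - S)} \<subseteq> \<Gamma> - S"
    proof
      fix \<delta> assume \<delta>: "\<delta> \<in> {c..c + card (\<Gamma> - S)}"
      then have "\<gamma> - \<delta> \<in> \<Gamma>" "\<delta> + (\<gamma> - \<delta>) = \<gamma>" "\<delta> \<in> \<Gamma>" using c large by auto
      then show "\<delta> \<in> \<Gamma> - S"
        using S \<gamma> by (metis DiffD2 DiffI semigroup_module_def)
    qed
    from card_mono[OF fin this] show False by simp
  qed
qed

theorem proposition2:
  fixes A :: "'k::{alg_closed_field, field_char_0} fps set"
    and r :: nat
  assumes "fps_subalgebra A"
    and "complete_local_ring (fps_subring A)"
    and "noetherian_domain (fps_subring A)"
    and "krull_dimension (fps_subring A) = 1"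
    and "has_normalization_fps A"
  shows "\<exists>(l::nat) (S :: nat \<Rightarrow> nat set).
           inj_on S {1..l} \<and>
           (\<forall>i\<in>{1..l}. semigroup_module (order_set A) (S i)) \<and>
           ideals_of_codimension A r = (\<Union>i\<in>{1..l}. ideals_with_order_set A (S i)) \<and>
           (\<forall>i\<in>{1..l}. \<forall>j\<in>{1..l}. i \<noteq> j \<longrightarrow>
              ideals_with_order_set A (S i) \<inter> ideals_with_order_set A (S j) = {})"
proof -
  interpret fps_subalg A by unfold_locales fact
  obtain b where b: "b \<in> A" "b \<noteq> 0" "\<And>f. b * f \<in> A"
    using exists_common_denominator assms(2,5) by blast
  define c where "c = subdegree b"
  \<comment> \<open>The unit ideal with its element \<open>1\<close> of order \<open>0\<close> gives
    this bound.\<close>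
  have conductor: "{c..} \<subseteq> order_set A"
    using fps_ord_ge_subset_imp_order_set[OF ideal_contains_high_order[OF b(2,3) A.oneideal, of 1]]
    by (simp add: c_def)
  have high: "\<exists>N. fps_ord_ge N \<subseteq> I" if I: "I \<in> nonzero_ideals A" for I
  proof -
    have ideal: "ideal I (fps_subring A)" and "I \<noteq> {0}"
      using I by (auto simp: nonzero_ideals_def)
    moreover have "0 \<in> I" by (rule ideal_closed(1)[OF ideal])
    ultimately obtain g where "g \<in> I" "g \<noteq> 0" by blast
    then show ?thesis using ideal_contains_high_order[OF b(2,3) ideal] by blast
  qed
  have codim_iff: "I \<in> ideals_of_codimension A r \<longleftrightarrow>
      I \<in> nonzero_ideals A \<and> r = card (order_set A - order_set I)" for I
    using high[of I] has_codimension_card_gaps[of I] has_codimension_unique[of I]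
    by (auto simp: ideals_of_codimension_def nonzero_ideals_def)
  have fin: "finite (order_set A - order_set I)" if I: "I \<in> nonzero_ideals A" for I
  proof -
    obtain N where "fps_ord_ge N \<subseteq> I" using high[OF I] by blast
    then have "order_set A - order_set I \<subseteq> {..<N}"
      using fps_ord_ge_subset_imp_order_set[of N I] by (auto simp: subset_eq)
    then show ?thesis by (rule finite_subset) simp
  qed
  have module: "semigroup_module (order_set A) (order_set I)" if "I \<in> nonzero_ideals A" for I
    using that by (intro order_set_semigroup_module) (simp add: nonzero_ideals_def)
  \<comment> \<open>The required modules are exactly the order sets that occur; if no ideal has
    codimension \<open>r\<close>, the list is empty.\<close>
  define T where "T = order_set ` ideals_of_codimension A r"
  \<comment> \<open>An order set is recovered from its set of gaps, which is a subset of a fixed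
    finite interval.\<close>
  have "T \<subseteq> (\<lambda>D. order_set A - D) ` Pow {..<2 * c + r}"
  proof
    fix S assume "S \<in> T"
    then obtain I where I: "I \<in> nonzero_ideals A" "r = card (order_set A - order_set I)" "S = order_set I"
      by (auto simp: T_def codim_iff)
    then have "order_set A - S \<subseteq> {..<2 * c + r}"
      using semigroup_module_gaps_bounded[OF module conductor fin] by simp
    moreover have "S = order_set A - (order_set A - S)"
      using module[OF I(1)] I(3) by (auto simp: semigroup_module_def)
    ultimately show "S \<in> (\<lambda>D. order_set A - D) ` Pow {..<2 * c + r}" by blast
  qed
  then have "finite T" by (rule finite_subset) simp
  then obtain S where S: "bij_betw S {1..card T} T"
    using ex_bij_betw_nat_finite_1 by blast
  then have inj: "inj_on S {1..card T}" and img: "S ` {1..card T} = T"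
    by (auto simp: bij_betw_def)
  \<comment> \<open>Codimension depends only on the order set, so each
    \<open>ideals_with_order_set A s\<close> with \<open>s\<close> in \<open>T\<close> lies wholly
    in codimension \<open>r\<close>.\<close>
  have "I \<in> ideals_of_codimension A r" if "I \<in> nonzero_ideals A" "order_set I \<in> T" for I
  proof -
    obtain J where "J \<in> ideals_of_codimension A r" "order_set I = order_set J"
      using \<open>order_set I \<in> T\<close> unfolding T_def by blast
    then show ?thesis
      using \<open>I \<in> nonzero_ideals A\<close> codim_iff[of I] codim_iff[of J] by simp
  qed
  moreover have "I \<in> nonzero_ideals A" if "I \<in> ideals_of_codimension A r" for I
    using that by (simp only: codim_iff)
  ultimately have "ideals_of_codimension A r = (\<Union>s\<in>T. ideals_with_order_set A s)"
    by (auto simp: ideals_with_order_set_def T_def)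
  also have "\<dots> = (\<Union>s\<in>S ` {1..card T}. ideals_with_order_set A s)"
    by (simp only: img)
  also have "\<dots> = (\<Union>i\<in>{1..card T}. ideals_with_order_set A (S i))"
    by simp
  finally have "ideals_of_codimension A r = (\<Union>i\<in>{1..card T}. ideals_with_order_set A (S i))" .
  moreover have "\<forall>i\<in>{1..card T}. semigroup_module (order_set A) (S i)"
  proof
    fix i assume "i \<in> {1..card T}"
    then have "S i \<in> T" using img by blast
    then obtain I where "I \<in> nonzero_ideals A" "S i = order_set I"
      by (auto simp: T_def ideals_of_codimension_def)
    then show "semigroup_module (order_set A) (S i)" using module by simp
  qed
  \<comment> \<open>A common ideal would have both \<open>S i\<close> and \<open>S j\<close> as its
    order set, against injectivity.\<close>
  moreover have "ideals_with_order_set A (S i) \<inter> ideals_with_order_set A (S j) = {}"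
    if "i \<in> {1..card T}" "j \<in> {1..card T}" "i \<noteq> j" for i j
    using inj_onD[OF inj _ that(1,2)] that(3) by (auto simp: ideals_with_order_set_def)
  ultimately show ?thesis using inj by blast
qed

end
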